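(* For every integer $t\geq1$, with $N_{t,1}=3t^2+2t$, $N_{t,2}=3t^2+4t+1$ and $N_{t,3}=3t^2+6t+2$, the following digraphs are tight $2$--Cayley digraphs over non-cyclic groups: (i) $\mathrm{Cay}(\mathbb{Z}_m\oplus\mathbb{Z}_{mN_{t,1}},\{(1,t),(2,2t+1)\})$ for $2\leq m\leq 6t+1$; (ii) $\mathrm{Cay}(\mathbb{Z}_m\oplus\mathbb{Z}_{mN_{t,2}},\{(1,t),(2,2t+1)\})$ for $2\leq m\leq 6t+3$; (iii) $\mathrm{Cay}(\mathbb{Z}_m\oplus\mathbb{Z}_{mN_{t,3}},\{(2,2t+1),(1,t)\})$ for $2\leq m\leq 2t+1$.
   Context: For a finite Abelian group $\mathrm{G}$ and $a,b\in\mathrm{G}\setminus\{0\}$ generating $\mathrm{G}$, $\mathrm{Cay}(\mathrm{G},\{a,b\})$ is the digraph with vertex set $\mathrm{G}$ and arcs $g\to g+a$, $g\to g+b$. Such a digraph of order $N$ is tight if its diameter equals $\lceil\sqrt{3N}\rceil-2$. *)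

theory Defs
  imports
    "HOL-Algebra.Elementary_Groups"
    "Graph_Theory.Pair_Digraph"
    "Graph_Theory.Shortest_Path"
begin

definition cayley_digraph :: "('g, 'x) monoid_scheme \<Rightarrow> 'g set \<Rightarrow> 'g pair_pre_digraph" where
  "cayley_digraph G S =
     \<lparr> pverts = carrier G,
       parcs = {(g, g \<otimes>\<^bsub>G\<^esub> s) | g s. g \<in> carrier G \<and> s \<in> S} \<rparr>"

(* The Graph_Theory distance is a constant of the locale wf_digraph, so its
   defining equation is only available for well-formed digraphs; Cayley digraphs are. *)
lemma wf_digraph_cayley_digraph:
  assumes "group G" "S \<subseteq> carrier G"
  shows "wf_digraph (with_proj (cayley_digraph G S))"
proof -
  interpret group G by fact
  show ?thesis
    using assms(2) by unfold_locales (auto simp: cayley_digraph_def)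
qed

(* With every arc of weight 1, the cost of a walk is its length; the distance to an
   unreachable vertex is infinite. *)
definition digraph_diameter :: "('v, 'e) pre_digraph \<Rightarrow> ereal" where
  "digraph_diameter D = (SUP u\<in>verts D. SUP v\<in>verts D. wf_digraph.\<mu> D (\<lambda>_. 1) u v)"

definition tight_digraph :: "('v, 'e) pre_digraph \<Rightarrow> bool" where
  "tight_digraph D \<longleftrightarrow>
     digraph_diameter D = ereal (real_of_int (\<lceil>sqrt (3 * real (card (verts D)))\<rceil> - 2))"

(* The group is written multiplicatively, so its neutral element is one rather than zero. *)
definition two_cayley_data :: "('g, 'x) monoid_scheme \<Rightarrow> 'g \<Rightarrow> 'g \<Rightarrow> bool" where
  "two_cayley_data G a b \<longleftrightarrow>
     comm_group G \<and> finite (carrier G) \<and>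
     a \<in> carrier G - {\<one>\<^bsub>G\<^esub>} \<and> b \<in> carrier G - {\<one>\<^bsub>G\<^esub>} \<and>
     generate G {a, b} = carrier G"

definition tight_two_cayley_digraph :: "('g, 'x) monoid_scheme \<Rightarrow> 'g \<Rightarrow> 'g \<Rightarrow> bool" where
  "tight_two_cayley_digraph G a b \<longleftrightarrow>
     two_cayley_data G a b \<and> tight_digraph (with_proj (cayley_digraph G {a, b}))"

definition ZZ_group :: "nat \<Rightarrow> nat \<Rightarrow> (int \<times> int) monoid" where
  "ZZ_group m n = integer_mod_group m \<times>\<times> integer_mod_group n"

(* The carrier of integer_mod_group n is {0..<n} for n > 0, so an integer pair has to be
   reduced to name an element of the direct sum: for m = 2, (2, y) denotes (0, y mod n). *)
definition ZZ_class :: "nat \<Rightarrow> nat \<Rightarrow> int \<times> int \<Rightarrow> int \<times> int" where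
  "ZZ_class m n p = (fst p mod int m, snd p mod int n)"

end

theory Submission
  imports Defs
begin

text \<open>
  Since \<open>(1, t)\<close> and \<open>(2, 2t + 1)\<close> have determinant \<open>1\<close>, the map
  \<open>(i, j) \<mapsto> i(1, t) + j(2, 2t + 1)\<close> identifies \<open>\<int>\<^sub>m \<oplus> \<int>\<^sub>m\<^sub>N\<close> with \<open>\<int>\<^sup>2 / mL\<close>, where \<open>L\<close> is the
  lattice of all \<open>(u, v)\<close> with \<open>N\<close> dividing \<open>tu + (2t + 1)v\<close>. For \<open>N\<close> equal to \<open>3t\<^sup>2 + 2t + s(2t + 1)\<close> and
  \<open>s = 0, 1, 2\<close> the lattice \<open>L\<close> is spanned by \<open>(l, -y)\<close> and \<open>(-w, h)\<close> with \<open>l = 2t + 1\<close>,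
  \<open>h = 2t + s\<close> and \<open>w = y = t\<close>: an L-shaped tile. Every class modulo \<open>L\<close> has a nonnegative
  representative inside the tile, so with coordinate sum at most \<open>l + h - y - 2\<close>, and the corner
  \<open>(l - 1, h - y - 1)\<close> has no nonnegative representative with a smaller sum. Both facts scale from
  \<open>L\<close> to \<open>mL\<close>, so the diameter is \<open>m(3t + 1 + s) - 2\<close>; the bounds on \<open>m\<close> make
  \<open>m(3t + 1 + s)\<close> equal to \<open>\<lceil>sqrt (3m\<^sup>2N)\<rceil>\<close>.
\<close>

subsection \<open>Distances in Cayley digraphs on two generators\<close>

lemma (in wf_digraph) awalk_cost_one: "awalk_cost (\<lambda>_. 1) p = real (length p)"
  by (induction p) auto

text \<open>Commutativity lets the steps of a walk be reordered, so its endpoint depends only on how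
  many arcs of each kind it uses.\<close>

lemma cayley_digraph_awalk_imp_powers:
  fixes G (structure)
  assumes "comm_group G" "a \<in> carrier G" "b \<in> carrier G"
    and "pre_digraph.awalk (with_proj (cayley_digraph G {a, b})) u p v"
  shows "\<exists>i j::nat. i + j = length p \<and> v = u \<otimes> (a [^] i \<otimes> b [^] j)"
proof -
  interpret comm_group G by fact
  interpret D: wf_digraph "with_proj (cayley_digraph G {a, b})"
    using assms by (intro wf_digraph_cayley_digraph) auto
  show ?thesis
    using assms(4)
  proof (induction p arbitrary: u)
    case Nil
    then have "u \<in> carrier G" "v = u"
      unfolding D.awalk_Nil_iff by (auto simp: cayley_digraph_def)
    then show ?case
      by (auto intro!: exI[of _ 0])
  next
    case (Cons e p)
    then have e: "e \<in> parcs (cayley_digraph G {a, b})" "fst e = u"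
      and "D.awalk (snd e) p v"
      by (auto simp: D.awalk_Cons_iff)
    with Cons.IH obtain i j :: nat
      where ij: "i + j = length p" "v = snd e \<otimes> (a [^] i \<otimes> b [^] j)"
      by blast
    from e have u: "u \<in> carrier G" and "snd e = u \<otimes> a \<or> snd e = u \<otimes> b"
      by (auto simp: cayley_digraph_def)
    then consider "snd e = u \<otimes> a" | "snd e = u \<otimes> b"
      by blast
    then show ?case
    proof cases
      case 1
      then have "v = u \<otimes> (a [^] Suc i \<otimes> b [^] j)"
        using ij u assms by (simp add: m_ac)
      then show ?thesis
        using ij(1) by (intro exI[of _ "Suc i"] exI[of _ j]) simp
    next
      case 2
      then have "v = u \<otimes> (a [^] i \<otimes> b [^] Suc j)"
        using ij u assms by (simp add: m_ac)
      then show ?thesis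
        using ij(1) by (intro exI[of _ i] exI[of _ "Suc j"]) simp
    qed
  qed
qed

lemma cayley_digraph_awalk_power:
  fixes G (structure)
  assumes "group G" "S \<subseteq> carrier G" "u \<in> carrier G" "s \<in> S"
  shows "\<exists>p. pre_digraph.awalk (with_proj (cayley_digraph G S)) u p (u \<otimes> s [^] (n::nat)) \<and> length p = n"
proof -
  interpret group G by fact
  interpret D: wf_digraph "with_proj (cayley_digraph G S)"
    using assms by (intro wf_digraph_cayley_digraph)
  have s: "s \<in> carrier G"
    using assms by blast
  show ?thesis
  proof (induction n)
    case 0
    show ?case
      using assms by (intro exI[of _ "[]"]) (simp add: D.awalk_Nil_iff, simp add: cayley_digraph_def)
  next
    case (Suc n)
    then obtain p where p: "D.awalk u p (u \<otimes> s [^] n)" "length p = n"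
      by blast
    have "D.awalk (u \<otimes> s [^] n) [(u \<otimes> s [^] n, u \<otimes> s [^] Suc n)] (u \<otimes> s [^] Suc n)"
      using assms s unfolding D.awalk_simps by (auto simp: cayley_digraph_def simp flip: m_assoc)
    with p show ?case
      by (intro exI[of _ "p @ [(u \<otimes> s [^] n, u \<otimes> s [^] Suc n)]"]) auto
  qed
qed

lemma cayley_digraph_awalk_of_powers:
  fixes G (structure)
  assumes "group G" "a \<in> carrier G" "b \<in> carrier G" "u \<in> carrier G"
  shows "\<exists>p. pre_digraph.awalk (with_proj (cayley_digraph G {a, b})) u p
    (u \<otimes> (a [^] (i::nat) \<otimes> b [^] (j::nat))) \<and> length p = i + j"
proof -
  interpret group G by fact
  interpret D: wf_digraph "with_proj (cayley_digraph G {a, b})"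
    using assms by (intro wf_digraph_cayley_digraph) auto
  obtain p where p: "D.awalk u p (u \<otimes> a [^] i)" "length p = i"
    using cayley_digraph_awalk_power[of G "{a, b}" u a i] assms by auto
  obtain q where q: "D.awalk (u \<otimes> a [^] i) q (u \<otimes> a [^] i \<otimes> b [^] j)" "length q = j"
    using cayley_digraph_awalk_power[of G "{a, b}" "u \<otimes> a [^] i" b j] assms by auto
  show ?thesis
    using p q assms by (intro exI[of _ "p @ q"]) (auto simp: m_assoc)
qed

text \<open>Translations preserve distances: going from \<open>u\<close> to \<open>v\<close> costs
  as much as writing \<open>inv u \<otimes> v\<close> as a word in \<open>a\<close> and
  \<open>b\<close>. So short words for all elements bound every distance, and one element
  \<open>c\<close> without a shorter word attains the bound from \<one>.\<close>

lemma digraph_diameter_cayley_digraph_eqI: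
  fixes G (structure) and d :: nat
  assumes "comm_group G" "a \<in> carrier G" "b \<in> carrier G"
    and upper: "\<And>g. g \<in> carrier G \<Longrightarrow> \<exists>i j::nat. i + j \<le> d \<and> g = a [^] i \<otimes> b [^] j"
    and c: "c \<in> carrier G"
    and lower: "\<And>i j::nat. c = a [^] i \<otimes> b [^] j \<Longrightarrow> d \<le> i + j"
  shows "digraph_diameter (with_proj (cayley_digraph G {a, b})) = ereal (real d)"
proof -
  interpret comm_group G by fact
  interpret D: wf_digraph "with_proj (cayley_digraph G {a, b})"
    using assms by (intro wf_digraph_cayley_digraph) auto
  have verts: "verts (with_proj (cayley_digraph G {a, b})) = carrier G"
    by (simp add: cayley_digraph_def)
  have le: "D.\<mu> (\<lambda>_. 1) u v \<le> ereal (real d)" if uv: "u \<in> carrier G" "v \<in> carrier G" for u v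
  proof -
    have "inv u \<otimes> v \<in> carrier G"
      using uv by simp
    from upper[OF this] obtain i j :: nat
      where ij: "i + j \<le> d" "inv u \<otimes> v = a [^] i \<otimes> b [^] j"
      by blast
    have "u \<otimes> (inv u \<otimes> v) = v"
      using uv by (simp flip: m_assoc)
    then obtain p where p: "D.awalk u p v" "length p = i + j"
      using cayley_digraph_awalk_of_powers[of G a b u i j] uv ij(2) assms(2,3) is_group by auto
    have "D.\<mu> (\<lambda>_. 1) u v \<le> ereal (real (i + j))"
      using D.min_cost_le_walk_cost[OF p(1), of "\<lambda>_. 1"] p(2) by (simp add: D.awalk_cost_one)
    also have "\<dots> \<le> ereal (real d)"
      using ij(1) by simp
    finally show ?thesis .
  qed
  have ge: "ereal (real d) \<le> D.\<mu> (\<lambda>_. 1) \<one> c"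
    unfolding D.\<mu>_def
  proof (rule INF_greatest)
    fix p assume "p \<in> {p. D.awalk \<one> p c}"
    then obtain i j :: nat where ij: "i + j = length p" "c = \<one> \<otimes> (a [^] i \<otimes> b [^] j)"
      using cayley_digraph_awalk_imp_powers[of G a b \<one> p c] assms by auto
    then have "d \<le> length p"
      using lower[of i j] assms by simp
    then show "ereal (real d) \<le> ereal (D.awalk_cost (\<lambda>_. 1) p)"
      by (simp add: D.awalk_cost_one)
  qed
  show ?thesis
    unfolding digraph_diameter_def verts
  proof (rule antisym)
    show "(SUP u\<in>carrier G. SUP v\<in>carrier G. D.\<mu> (\<lambda>_. 1) u v) \<le> ereal (real d)"
      by (intro SUP_least le)
    show "ereal (real d) \<le> (SUP u\<in>carrier G. SUP v\<in>carrier G. D.\<mu> (\<lambda>_. 1) u v)"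
      by (rule SUP_upper2[OF one_closed], rule SUP_upper2[OF c], rule ge)
  qed
qed

subsection \<open>The groups \<open>\<int>\<^sub>m \<oplus> \<int>\<^sub>n\<close>\<close>

lemma comm_group_ZZ_group: "comm_group (ZZ_group m n)"
proof (rule group.group_comm_groupI)
  show "group (ZZ_group m n)"
    unfolding ZZ_group_def by (intro DirProd_group) auto
qed (auto simp: ZZ_group_def add.commute)

lemma group_ZZ_group: "group (ZZ_group m n)"
  using comm_group_ZZ_group by (rule comm_group.axioms)

lemma carrier_ZZ_group:
  assumes "m > 0" "n > 0"
  shows "carrier (ZZ_group m n) = {0..<int m} \<times> {0..<int n}"
  using assms by (simp add: ZZ_group_def carrier_integer_mod_group)

lemma int_pow_ZZ_group:
  assumes x: "x \<in> carrier (ZZ_group m n)"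
  shows "x [^]\<^bsub>ZZ_group m n\<^esub> (k::int) = ZZ_class m n (k * fst x, k * snd x)"
proof -
  let ?A = "integer_mod_group m" and ?B = "integer_mod_group n"
  have "fst \<in> hom (?A \<times>\<times> ?B) ?A" "snd \<in> hom (?A \<times>\<times> ?B) ?B"
    by (auto simp: hom_def mult_DirProd')
  then show ?thesis
    using hom_int_pow[of fst "?A \<times>\<times> ?B" ?A x k] hom_int_pow[of snd "?A \<times>\<times> ?B" ?B x k]
      x group_ZZ_group[of m n]
    by (simp add: ZZ_group_def ZZ_class_def int_pow_integer_mod_group prod_eq_iff)
qed

lemma ZZ_class_in_carrier:
  assumes "m > 0" "n > 0"
  shows "ZZ_class m n x \<in> carrier (ZZ_group m n)"
  using assms by (simp add: carrier_ZZ_group ZZ_class_def)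

lemma ZZ_class_of_carrier:
  assumes "m > 0" "n > 0" "x \<in> carrier (ZZ_group m n)"
  shows "ZZ_class m n x = x"
  using assms by (auto simp: carrier_ZZ_group ZZ_class_def)

lemma ZZ_class_eq_iff:
  "ZZ_class m n x = ZZ_class m n y \<longleftrightarrow>
     int m dvd fst x - fst y \<and> int n dvd snd x - snd y"
  by (simp add: ZZ_class_def mod_eq_dvd_iff)

lemma mult_ZZ_class:
  "ZZ_class m n x \<otimes>\<^bsub>ZZ_group m n\<^esub> ZZ_class m n y = ZZ_class m n (fst x + fst y, snd x + snd y)"
  by (simp add: ZZ_class_def ZZ_group_def mod_add_eq)

lemma nat_pow_ZZ_class:
  assumes "m > 0" "n > 0"
  shows "ZZ_class m n x [^]\<^bsub>ZZ_group m n\<^esub> (k::nat) = ZZ_class m n (int k * fst x, int k * snd x)"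
  using int_pow_ZZ_group[OF ZZ_class_in_carrier[OF assms], of x "int k"]
  by (simp add: int_pow_int ZZ_class_def mod_mult_right_eq)

text \<open>If \<open>x\<close> generates with \<open>kx = (1, 0)\<close> and \<open>k'x = (0, 1)\<close>, then modulo \<open>m\<close> the product
  \<open>k x\<^sub>1 k' x\<^sub>2\<close> is both \<open>1\<close> and \<open>k x\<^sub>2 k' x\<^sub>1 = 0\<close>.\<close>

lemma not_cyclic_group_ZZ_group:
  assumes m: "m \<ge> 2" and n: "n > 0" "m dvd n"
  shows "\<not> cyclic_group (ZZ_group m n)"
proof
  let ?G = "ZZ_group m n"
  assume "cyclic_group ?G"
  then obtain x where x: "x \<in> carrier ?G" "carrier ?G = range (\<lambda>k::int. x [^]\<^bsub>?G\<^esub> k)"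
    using group.cyclic_group[OF group_ZZ_group] by blast
  have pos: "m > 0"
    using m by simp
  have "ZZ_class m n (1, 0) \<in> range (\<lambda>k::int. x [^]\<^bsub>?G\<^esub> k)"
    "ZZ_class m n (0, 1) \<in> range (\<lambda>k::int. x [^]\<^bsub>?G\<^esub> k)"
    using ZZ_class_in_carrier[OF pos n(1)] x(2) by blast+
  then obtain k k' :: int
    where k: "ZZ_class m n (1, 0) = ZZ_class m n (k * fst x, k * snd x)"
      and k': "ZZ_class m n (0, 1) = ZZ_class m n (k' * fst x, k' * snd x)"
    by (auto simp: int_pow_ZZ_group[OF x(1)])
  have mn: "int m dvd z" if "int n dvd z" for z
    using that n(2) by (meson dvd_trans int_dvd_int_iff)
  have "int m dvd (1 - k * fst x) * (k' * snd x)"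
    using k by (simp add: ZZ_class_eq_iff)
  moreover have "int m dvd 1 - k' * snd x"
    using k' mn by (simp add: ZZ_class_eq_iff)
  moreover have "int m dvd (0 - k * snd x) * (k' * fst x)"
    using k mn by (metis ZZ_class_eq_iff dvd_mult2 snd_conv)
  ultimately have "int m dvd (1 - k * fst x) * (k' * snd x) + (1 - k' * snd x)
      - (0 - k * snd x) * (k' * fst x)"
    using dvd_add dvd_diff by blast
  also have "\<dots> = 1"
    by (simp add: algebra_simps)
  finally have "int m dvd 1" .
  then show False
    using m by simp
qed

subsection \<open>L-shaped tiles\<close>

text \<open>Descent: subtracting \<open>(l, -y)\<close>, \<open>(-w, h)\<close> or their sum
  \<open>(l - w, h - y)\<close> keeps the residue and lowers the coordinate sum. One of the three is
  possible, with a nonnegative result, at every nonnegative point outside the tile.\<close>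

lemma L_shape_reduction:
  fixes p q N l h w y i j r :: int
  assumes 1: "N dvd p * l - q * y" and 2: "N dvd q * h - p * w"
    and bounds: "0 \<le> y" "y < l" "0 \<le> w" "w < h" "w \<le> l" "y \<le> h"
    and ij: "0 \<le> i" "0 \<le> j" "N dvd p * i + q * j - r"
  shows "\<exists>i' j'. 0 \<le> i' \<and> 0 \<le> j' \<and> i' + j' \<le> max (l + h - y) (l + h - w) - 2 \<and>
    N dvd p * i' + q * j' - r"
  using ij
proof (induction "nat (i + j)" arbitrary: i j rule: less_induct)
  case less
  consider "l \<le> i" | "h \<le> j" | "l - w \<le> i" "h - y \<le> j" | "i < l" "j < h" "i < l - w \<or> j < h - y"
    by linarith
  then show ?case
  proof cases
    case 1
    have "N dvd (p * i + q * j - r) - (p * l - q * y)"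
      by (rule dvd_diff[OF less.prems(3) assms(1)])
    then have "N dvd p * (i - l) + q * (j + y) - r"
      by (simp add: algebra_simps)
    with 1 show ?thesis
      using bounds less.prems by (intro less.hyps[of "i - l" "j + y"]) auto
  next
    case 2
    have "N dvd (p * i + q * j - r) - (q * h - p * w)"
      by (rule dvd_diff[OF less.prems(3) assms(2)])
    then have "N dvd p * (i + w) + q * (j - h) - r"
      by (simp add: algebra_simps)
    with 2 show ?thesis
      using bounds less.prems by (intro less.hyps[of "i + w" "j - h"]) auto
  next
    case 3
    have "N dvd (p * i + q * j - r) - (p * l - q * y) - (q * h - p * w)"
      by (rule dvd_diff[OF dvd_diff[OF less.prems(3) assms(1)] assms(2)])
    then have "N dvd p * (i - (l - w)) + q * (j - (h - y)) - r"
      by (simp add: algebra_simps)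
    with 3 show ?thesis
      using bounds less.prems by (intro less.hyps[of "i - (l - w)" "j - (h - y)"]) auto
  next
    \<comment> \<open>The point lies in the rectangle \<open>l\<close> by \<open>h\<close> with a
      \<open>w\<close> by \<open>y\<close> block cut from its far corner. The maximum comes from the
      outer corners \<open>(l - 1, h - y - 1)\<close> and \<open>(l - w - 1, h - 1)\<close>.\<close>
    case 4
    then show ?thesis
      using less.prems by (intro exI[of _ i] exI[of _ j]) auto
  qed
qed

text \<open>With \<open>u = al - bw\<close> and \<open>v = bh - ay\<close>, no lattice vector moves the corner
  \<open>(l - 1, h - y - 1)\<close> to a nonnegative point with a smaller coordinate sum.\<close>

lemma L_shape_corner:
  fixes a b l h w y :: int
  assumes "0 < l" "0 \<le> w" "w \<le> l" "w \<le> h" "0 \<le> y" "y \<le> l" "y \<le> h"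
    and u: "a * l - b * w > - l" and v: "b * h - a * y > y - h"
  shows "0 \<le> (a * l - b * w) + (b * h - a * y)"
proof -
  have A: "(a + 1) * l > b * w" and B: "(b + 1) * h > (a + 1) * y"
    using u v by (simp_all add: algebra_simps)
  \<comment> \<open>A negative \<open>a\<close> would force \<open>b\<close> \<le> \<open>a\<close>
    by \<open>A\<close>, which contradicts \<open>B\<close>.\<close>
  have "0 \<le> a"
  proof (rule ccontr)
    assume "\<not> 0 \<le> a"
    then have "(a + 1) * l \<le> (a + 1) * w"
      using assms by (intro mult_left_mono_neg) auto
    with A have "b * w < (a + 1) * w"
      by linarith
    then have "b + 1 \<le> a + 1"
      using \<open>0 \<le> w\<close> by (simp add: mult_less_cancel_right)
    then have "(b + 1) * h \<le> (a + 1) * h"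
      using assms by (intro mult_right_mono) auto
    also have "\<dots> \<le> (a + 1) * y"
      using assms \<open>\<not> 0 \<le> a\<close> by (intro mult_left_mono_neg) auto
    finally show False
      using B by simp
  qed
  then have "0 < (b + 1) * h"
    using B \<open>0 \<le> y\<close> by (smt (verit) mult_nonneg_nonneg)
  then have "0 \<le> b"
    using assms by (simp add: zero_less_mult_iff)
  have "0 \<le> a * (l - y) + b * (h - w)"
    using assms \<open>0 \<le> a\<close> \<open>0 \<le> b\<close> by simp
  then show ?thesis
    by (simp add: algebra_simps)
qed

subsection \<open>The three families\<close>

lemma exists_small_representative:
  fixes t s N :: nat and r :: int
  assumes "t \<ge> 1" "s \<le> 2" "N = 3 * t\<^sup>2 + 2 * t + s * (2 * t + 1)"
  shows "\<exists>i j. 0 \<le> i \<and> 0 \<le> j \<and> i + j \<le> int (3 * t + 1 + s) - 2 \<and>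
    int N dvd int t * i + (2 * int t + 1) * j - r"
proof -
  \<comment> \<open>As \<open>-2 * t + (2 * t + 1) = 1\<close>, the point \<open>(-2 * r, r)\<close>
    has residue \<open>r\<close>; reducing its coordinates modulo \<open>N\<close> makes them
    nonnegative.\<close>
  define i j where "i = (- 2 * r) mod int N" and "j = r mod int N"
  have N: "N > 0"
    using assms by simp
  have ij: "0 \<le> i" "0 \<le> j"
    using N by (simp_all add: i_def j_def)
  have "i mod int N = (- 2 * r) mod int N" "j mod int N = r mod int N"
    by (simp_all add: i_def j_def)
  then have "int N dvd int t * (i - (- 2 * r)) + (2 * int t + 1) * (j - r)"
    unfolding mod_eq_dvd_iff by (intro dvd_add dvd_mult)
  then have dvd: "int N dvd int t * i + (2 * int t + 1) * j - r"
    by (simp add: algebra_simps)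
  have 1: "int N dvd int t * (2 * int t + 1) - (2 * int t + 1) * int t"
    by (simp add: algebra_simps)
  \<comment> \<open>This difference is \<open>N\<close> itself, the area
    \<open>l * h - w * y\<close> of the tile.\<close>
  have 2: "int N dvd (2 * int t + 1) * (2 * int t + int s) - int t * int t"
    by (simp add: assms algebra_simps power2_eq_square)
  have "\<exists>i' j'. 0 \<le> i' \<and> 0 \<le> j' \<and>
      i' + j' \<le> max (2 * int t + 1 + (2 * int t + int s) - int t)
        (2 * int t + 1 + (2 * int t + int s) - int t) - 2 \<and>
      int N dvd int t * i' + (2 * int t + 1) * j' - r"
    using assms by (intro L_shape_reduction[OF 1 2 _ _ _ _ _ _ ij dvd]) auto
  then show ?thesis
    by (simp add: algebra_simps)
qed

text \<open>The coefficients \<open>a\<close>, \<open>b\<close> solve \<open>(u, v) = a(2t + 1, -t) + b(-t, 2t + s)\<close>.\<close>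

lemma corner_is_far:
  fixes t s N :: nat and u v :: int
  assumes "s \<le> 2" "N = 3 * t\<^sup>2 + 2 * t + s * (2 * t + 1)"
    and dvd: "int N dvd int t * u + (2 * int t + 1) * v"
    and "u > - (2 * int t + 1)" "v > - (int t + int s)"
  shows "0 \<le> u + v"
proof -
  obtain b where b: "int t * u + (2 * int t + 1) * v = int N * b"
    using dvd by (elim dvdE)
  \<comment> \<open>Cramer's rule with determinant \<open>N\<close> gives \<open>b\<close>. In
    \<open>u + 2 * v\<close> the coefficient of \<open>a\<close> is 1 and that of \<open>b\<close>
    is \<open>3 * t + 2 * s\<close>, so \<open>a\<close> is found without division.\<close>
  define a where "a = u + 2 * v - b * (3 * int t + 2 * int s)"
  have v: "v = b * (2 * int t + int s) - a * int t"
    using b by (simp add: assms a_def algebra_simps power2_eq_square)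
  have u: "u = a * (2 * int t + 1) - b * int t"
    using v by (simp add: a_def algebra_simps)
  show ?thesis
    using L_shape_corner[of "2 * int t + 1" "int t" "2 * int t + int s" "int t" a b] assms
    by (simp add: flip: u v)
qed

lemma digraph_diameter_ZZ_group:
  fixes t s m N :: nat
  assumes "t \<ge> 1" "s \<le> 2" "N = 3 * t\<^sup>2 + 2 * t + s * (2 * t + 1)" "m > 0"
  defines "G \<equiv> ZZ_group m (m * N)"
    and "a \<equiv> ZZ_class m (m * N) (1, int t)" and "b \<equiv> ZZ_class m (m * N) (2, 2 * int t + 1)"
  shows "digraph_diameter (with_proj (cayley_digraph G {a, b})) =
      ereal (real (m * (3 * t + 1 + s) - 2))"
    and "generate G {a, b} = carrier G"
proof -
  have N: "m * N > 0"
    using assms by simp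
  have a: "a \<in> carrier G" and b: "b \<in> carrier G"
    using ZZ_class_in_carrier[OF \<open>m > 0\<close> N] by (simp_all add: a_def b_def G_def)
  have prod_eq: "a [^]\<^bsub>G\<^esub> i \<otimes>\<^bsub>G\<^esub> b [^]\<^bsub>G\<^esub> j =
      ZZ_class m (m * N) (int i + 2 * int j, int t * int i + (2 * int t + 1) * int j)" for i j :: nat
    unfolding a_def b_def G_def
    unfolding nat_pow_ZZ_class[OF \<open>m > 0\<close> N] mult_ZZ_class by (simp add: mult.commute)
  have upper: "\<exists>i j::nat. i + j \<le> m * (3 * t + 1 + s) - 2 \<and> g = a [^]\<^bsub>G\<^esub> i \<otimes>\<^bsub>G\<^esub> b [^]\<^bsub>G\<^esub> j"
    if g: "g \<in> carrier G" for g
  proof -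
    \<comment> \<open>Integer coordinates of \<open>g\<close> in the basis \<open>(1, t)\<close>,
      \<open>(2, 2 * t + 1)\<close>, by inverting a matrix of determinant 1.\<close>
    define i0 j0 where "i0 = (2 * int t + 1) * fst g - 2 * snd g" and "j0 = snd g - int t * fst g"
    obtain i' j' where ij': "0 \<le> i'" "0 \<le> j'" "i' + j' \<le> int (3 * t + 1 + s) - 2"
      "int N dvd int t * i' + (2 * int t + 1) * j'
        - (int t * (i0 div int m) + (2 * int t + 1) * (j0 div int m))"
      using exists_small_representative[OF assms(1-3)] by blast
    define u v where "u = i' - i0 div int m" and "v = j' - j0 div int m"
    \<comment> \<open>Only the quotients by \<open>m\<close> are moved into the tile; the remainders
      stay. They add at most \<open>2 * (m - 1)\<close>, which turns
      \<open>m * (3 * t + 1 + s - 2)\<close> into \<open>m * (3 * t + 1 + s) - 2\<close>.\<close>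
    define i j where "i = int m * i' + i0 mod int m" and "j = int m * j' + j0 mod int m"
    have i: "i = i0 + int m * u" and j: "j = j0 + int m * v"
      using mult_div_mod_eq[of "int m" i0] mult_div_mod_eq[of "int m" j0]
      by (simp_all add: i_def j_def u_def v_def algebra_simps)
    have nonneg: "0 \<le> i" "0 \<le> j"
      using ij' \<open>m > 0\<close> by (simp_all add: i_def j_def)
    have "i0 mod int m \<le> int m - 1" "j0 mod int m \<le> int m - 1"
      using \<open>m > 0\<close> by simp_all
    moreover have "int m * (i' + j') \<le> int m * (int (3 * t + 1 + s) - 2)"
      using ij' by (intro mult_left_mono) auto
    ultimately have "i + j \<le> int (m * (3 * t + 1 + s)) - 2"
      by (simp add: i_def j_def algebra_simps)
    then have "nat i + nat j \<le> m * (3 * t + 1 + s) - 2"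
      using nonneg by linarith
    moreover have "g = a [^]\<^bsub>G\<^esub> nat i \<otimes>\<^bsub>G\<^esub> b [^]\<^bsub>G\<^esub> nat j"
    proof -
      have "int N dvd int t * u + (2 * int t + 1) * v"
        using ij'(4) by (simp add: u_def v_def algebra_simps)
      then have dvd: "int m * int N dvd int m * (int t * u + (2 * int t + 1) * v)"
        by (rule mult_dvd_mono[OF dvd_refl])
      have "i + 2 * j - fst g = int m * (u + 2 * v)"
        "int t * i + (2 * int t + 1) * j - snd g = int m * (int t * u + (2 * int t + 1) * v)"
        by (simp_all add: i j i0_def j0_def algebra_simps)
      then have "ZZ_class m (m * N) (i + 2 * j, int t * i + (2 * int t + 1) * j) = ZZ_class m (m * N) g"
        using dvd by (simp add: ZZ_class_eq_iff)
      then show ?thesis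
        using nonneg g ZZ_class_of_carrier[OF \<open>m > 0\<close> N, of g] unfolding prod_eq
        by (simp add: G_def)
    qed
    ultimately show ?thesis
      by blast
  qed
  show "generate G {a, b} = carrier G"
  proof
    interpret group G
      unfolding G_def by (rule group_ZZ_group)
    show "generate G {a, b} \<subseteq> carrier G"
      using a b by (intro generate_incl) auto
    interpret H: subgroup "generate G {a, b}" G
      using a b by (intro generate_is_subgroup) auto
    have pow: "x [^]\<^bsub>G\<^esub> (k::nat) \<in> generate G {a, b}" if "x \<in> {a, b}" for x k
      using that by (induction k) (auto intro: generate.incl)
    show "carrier G \<subseteq> generate G {a, b}"
    proof
      fix g assume "g \<in> carrier G"
      then obtain i j :: nat where "g = a [^]\<^bsub>G\<^esub> i \<otimes>\<^bsub>G\<^esub> b [^]\<^bsub>G\<^esub> j"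
        using upper by blast
      then show "g \<in> generate G {a, b}"
        using pow[of a i] pow[of b j] by simp
    qed
  qed
  \<comment> \<open>The outer corner \<open>(m * l - 1, m * (h - y) - 1)\<close> of the tile scaled
    by \<open>m\<close>.\<close>
  define i0 j0 where "i0 = int m * (2 * int t + 1) - 1" and "j0 = int m * (int t + int s) - 1"
  show "digraph_diameter (with_proj (cayley_digraph G {a, b})) =
      ereal (real (m * (3 * t + 1 + s) - 2))"
  proof (rule digraph_diameter_cayley_digraph_eqI[OF _ a b upper])
    show "comm_group G"
      unfolding G_def by (rule comm_group_ZZ_group)
    show "ZZ_class m (m * N) (i0 + 2 * j0, int t * i0 + (2 * int t + 1) * j0) \<in> carrier G"
      unfolding G_def by (rule ZZ_class_in_carrier[OF \<open>m > 0\<close> N])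
  next
    fix i j :: nat
    define x y where "x = (int i - i0) + 2 * (int j - j0)"
      and "y = int t * (int i - i0) + (2 * int t + 1) * (int j - j0)"
    assume "ZZ_class m (m * N) (i0 + 2 * j0, int t * i0 + (2 * int t + 1) * j0) =
      a [^]\<^bsub>G\<^esub> i \<otimes>\<^bsub>G\<^esub> b [^]\<^bsub>G\<^esub> j"
    then have "int m dvd - x" "int (m * N) dvd - y"
      unfolding prod_eq ZZ_class_eq_iff by (simp_all add: x_def y_def algebra_simps)
    then have x: "int m dvd x" and y: "int m * int N dvd y"
      by simp_all
    then have "int m dvd y"
      using dvd_mult_left by blast
    \<comment> \<open>Inverting the same matrix carries divisibility by \<open>m\<close> from
      \<open>x\<close> and \<open>y\<close> over to the displacement from the corner.\<close>
    moreover have "int i - i0 = (2 * int t + 1) * x - 2 * y" "int j - j0 = y - int t * x"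
      by (simp_all add: x_def y_def algebra_simps)
    ultimately have "int m dvd int i - i0" "int m dvd int j - j0"
      using x by (metis dvd_diff dvd_mult)+
    then obtain u v where u: "int i - i0 = int m * u" and v: "int j - j0 = int m * v"
      by (elim dvdE)
    have "y = int m * (int t * u + (2 * int t + 1) * v)"
      by (simp add: y_def u v algebra_simps)
    then have "int N dvd int t * u + (2 * int t + 1) * v"
      using y \<open>m > 0\<close> by simp
    \<comment> \<open>The two products equal \<open>i + 1\<close> and \<open>j + 1\<close>, so
      nonnegativity of \<open>i\<close> and \<open>j\<close> gives exactly the strict bounds
      required by \<open>corner_is_far\<close>.\<close>
    moreover have "int m * (u + (2 * int t + 1)) > 0" "int m * (v + (int t + int s)) > 0"
      using u v by (simp_all add: i0_def j0_def algebra_simps)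
    then have "u > - (2 * int t + 1)" "v > - (int t + int s)"
      using \<open>m > 0\<close> by (simp_all add: zero_less_mult_iff)
    ultimately have "0 \<le> int m * (u + v)"
      using corner_is_far[OF assms(2,3)] by simp
    then have "i0 + j0 \<le> int i + int j"
      using u v by (simp add: algebra_simps)
    moreover have "i0 + j0 = int (m * (3 * t + 1 + s)) - 2"
      by (simp add: i0_def j0_def algebra_simps)
    ultimately show "m * (3 * t + 1 + s) - 2 \<le> i + j"
      by linarith
  qed
qed

text \<open>Here \<open>1 - s + s\<^sup>2\<close> is the defect \<open>(3t + 1 + s)\<^sup>2 - 3N\<close>.\<close>

lemma ceiling_sqrt_order:
  fixes t s m N :: nat
  assumes "s \<le> 2" "N = 3 * t\<^sup>2 + 2 * t + s * (2 * t + 1)" "m \<ge> 2"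
    and m: "int m * (1 - int s + (int s)\<^sup>2) \<le> 2 * int (3 * t + 1 + s) - 1"
  shows "\<lceil>sqrt (3 * real (m * (m * N)))\<rceil> = int (m * (3 * t + 1 + s))"
proof -
  define k e :: int where "k = int (3 * t + 1 + s)" and "e = 1 - int s + (int s)\<^sup>2"
  have N: "3 * int N = k\<^sup>2 - e"
    by (simp add: assms k_def e_def algebra_simps power2_eq_square)
  have e: "0 \<le> e"
    using \<open>s \<le> 2\<close> by (auto simp: e_def power2_eq_square le_Suc_eq numeral_2_eq_2)
  have order: "3 * int (m * (m * N)) = (int m * k)\<^sup>2 - int m * (int m * e)"
    using arg_cong[OF N, of "\<lambda>x. (int m)\<^sup>2 * x"] by (simp add: algebra_simps power2_eq_square)
  have "int m * (int m * e) \<le> int m * (2 * k - 1)"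
    using m by (intro mult_left_mono) (auto simp: k_def e_def)
  \<comment> \<open>The right side is at least \<open>(m * k)^2 - 2 * m * k + m\<close>, which
    exceeds the square on the left because \<open>m > 1\<close>.\<close>
  then have "(int m * k - 1)\<^sup>2 < 3 * int (m * (m * N))"
    using \<open>m \<ge> 2\<close> unfolding order by (simp add: algebra_simps power2_eq_square)
  then have "real_of_int ((int m * k - 1)\<^sup>2) < real_of_int (3 * int (m * (m * N)))"
    by (simp only: of_int_less_iff)
  then have lo: "real_of_int (int m * k - 1) < sqrt (3 * real (m * (m * N)))"
    by (intro real_less_rsqrt) simp
  have "3 * int (m * (m * N)) \<le> (int m * k)\<^sup>2"
    unfolding order using e by simp
  then have "real_of_int (3 * int (m * (m * N))) \<le> real_of_int ((int m * k)\<^sup>2)"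
    by (simp only: of_int_le_iff)
  then have hi: "sqrt (3 * real (m * (m * N))) \<le> real_of_int (int m * k)"
    by (intro real_le_lsqrt) (simp_all add: k_def)
  have "\<lceil>sqrt (3 * real (m * (m * N)))\<rceil> = int m * k"
    using lo hi by (intro ceiling_unique) auto
  then show ?thesis
    by (simp only: k_def of_nat_mult)
qed

text \<open>For \<open>s = 0, 1, 2\<close> the last hypothesis reads \<open>m\<close> \<le>
  \<open>6 * t + 1\<close>, \<open>m\<close> \<le> \<open>6 * t + 3\<close> and \<open>3 * m\<close>
  \<le> \<open>6 * t + 5\<close>; over the integers the last means \<open>m\<close> \<le>
  \<open>2 * t + 1\<close>.\<close>

lemma tight_two_cayley_digraph_ZZ_group:
  fixes t s m N :: nat
  assumes "t \<ge> 1" "s \<le> 2" "N = 3 * t\<^sup>2 + 2 * t + s * (2 * t + 1)" "m \<ge> 2"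
    and "int m * (1 - int s + (int s)\<^sup>2) \<le> 2 * int (3 * t + 1 + s) - 1"
  shows "tight_two_cayley_digraph (ZZ_group m (m * N))
      (ZZ_class m (m * N) (1, int t)) (ZZ_class m (m * N) (2, 2 * int t + 1))"
    (is "tight_two_cayley_digraph ?G ?a ?b")
proof -
  have m: "m > 0" and N: "m * N > 0"
    using assms by simp_all
  have card: "card (carrier ?G) = m * (m * N)"
    using m N by (simp add: carrier_ZZ_group card_cartesian_product nat_mult_distrib)
  \<comment> \<open>For \<open>m = 2\<close> the first coordinate of \<open>?b\<close> vanishes, so
    \<open>?b\<close> is told apart from the identity by its second coordinate.\<close>
  have "2 * t + 1 < 2 * N"
    using assms by simp
  also have "\<dots> \<le> m * N"
    using \<open>m \<ge> 2\<close> by simp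
  finally have "int (2 * t + 1) < int (m * N)"
    by (simp only: of_nat_less_iff)
  then have "(2 * int t + 1) mod (int m * int N) \<noteq> 0"
    by (subst mod_pos_pos_trivial) simp_all
  then have "?b \<noteq> \<one>\<^bsub>?G\<^esub>" "?a \<noteq> \<one>\<^bsub>?G\<^esub>"
    using \<open>m \<ge> 2\<close> by (simp_all add: ZZ_class_def ZZ_group_def)
  moreover have "finite (carrier ?G)"
    using m N by (simp add: carrier_ZZ_group)
  ultimately have data: "two_cayley_data ?G ?a ?b"
    using comm_group_ZZ_group ZZ_class_in_carrier[OF m N] digraph_diameter_ZZ_group(2)[OF assms(1-3) m]
    by (simp add: two_cayley_data_def)
  \<comment> \<open>This keeps the subtraction of 2 on naturals from truncating, so it agrees with
    the integer one in \<open>tight_digraph\<close>.\<close>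
  have "2 * 1 \<le> m * (3 * t + 1 + s)"
    using \<open>m \<ge> 2\<close> by (intro mult_le_mono) auto
  then have "tight_digraph (with_proj (cayley_digraph ?G {?a, ?b}))"
    using digraph_diameter_ZZ_group(1)[OF assms(1-3) m] ceiling_sqrt_order[OF assms(2-5)]
    unfolding tight_digraph_def by (simp add: cayley_digraph_def card)
  with data show ?thesis
    by (simp add: tight_two_cayley_digraph_def)
qed

text \<open>Needed because the third family lists its generators in the opposite order.\<close>

lemma tight_two_cayley_digraph_commute:
  "tight_two_cayley_digraph G a b \<longleftrightarrow> tight_two_cayley_digraph G b a"
  by (auto simp: tight_two_cayley_digraph_def two_cayley_data_def insert_commute)

theorem theorem7:
  fixes t N1 N2 N3 :: nat
  assumes "t \<ge> 1"
    and "N1 = 3 * t^2 + 2 * t"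
    and "N2 = 3 * t^2 + 4 * t + 1"
    and "N3 = 3 * t^2 + 6 * t + 2"
  shows
    "(\<forall>m::nat. 2 \<le> m \<and> m \<le> 6 * t + 1 \<longrightarrow>
        tight_two_cayley_digraph (ZZ_group m (m * N1))
          (ZZ_class m (m * N1) (1, int t)) (ZZ_class m (m * N1) (2, 2 * int t + 1)) \<and>
        \<not> cyclic_group (ZZ_group m (m * N1))) \<and>
     (\<forall>m::nat. 2 \<le> m \<and> m \<le> 6 * t + 3 \<longrightarrow>
        tight_two_cayley_digraph (ZZ_group m (m * N2))
          (ZZ_class m (m * N2) (1, int t)) (ZZ_class m (m * N2) (2, 2 * int t + 1)) \<and>
        \<not> cyclic_group (ZZ_group m (m * N2))) \<and>
     (\<forall>m::nat. 2 \<le> m \<and> m \<le> 2 * t + 1 \<longrightarrow>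
        tight_two_cayley_digraph (ZZ_group m (m * N3))
          (ZZ_class m (m * N3) (2, 2 * int t + 1)) (ZZ_class m (m * N3) (1, int t)) \<and>
        \<not> cyclic_group (ZZ_group m (m * N3)))"
proof (intro conjI allI impI)
  fix m :: nat
  have pos: "N1 > 0" "N2 > 0" "N3 > 0"
    using assms by simp_all
  {
    assume m: "2 \<le> m \<and> m \<le> 6 * t + 1"
    show "tight_two_cayley_digraph (ZZ_group m (m * N1))
        (ZZ_class m (m * N1) (1, int t)) (ZZ_class m (m * N1) (2, 2 * int t + 1))"
      using assms m by (intro tight_two_cayley_digraph_ZZ_group[where s = 0]) simp_all
    show "\<not> cyclic_group (ZZ_group m (m * N1))"
      using m pos by (intro not_cyclic_group_ZZ_group) auto
  next
    assume m: "2 \<le> m \<and> m \<le> 6 * t + 3"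
    show "tight_two_cayley_digraph (ZZ_group m (m * N2))
        (ZZ_class m (m * N2) (1, int t)) (ZZ_class m (m * N2) (2, 2 * int t + 1))"
      using assms m by (intro tight_two_cayley_digraph_ZZ_group[where s = 1]) simp_all
    show "\<not> cyclic_group (ZZ_group m (m * N2))"
      using m pos by (intro not_cyclic_group_ZZ_group) auto
  next
    assume m: "2 \<le> m \<and> m \<le> 2 * t + 1"
    show "tight_two_cayley_digraph (ZZ_group m (m * N3))
        (ZZ_class m (m * N3) (2, 2 * int t + 1)) (ZZ_class m (m * N3) (1, int t))"
      unfolding tight_two_cayley_digraph_commute[of _ "ZZ_class m (m * N3) (2, 2 * int t + 1)"]
      using assms m by (intro tight_two_cayley_digraph_ZZ_group[where s = 2]) simp_all
    show "\<not> cyclic_group (ZZ_group m (m * N3))"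
      using m pos by (intro not_cyclic_group_ZZ_group) auto
  }
qed

end
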